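(* Let $T$ be a tournament (on 8 vertices) with score sequence $(1,2,2,3,5,5,5,5)$, $(2,2,2,2,5,5,5,5)$ or $(2,2,2,2,4,5,5,6)$. Then $T$ is not intrinsically linked as a directed graph.
   Context: A tournament is a directed graph with exactly one directed edge between each pair of distinct vertices. Its score sequence is the list of outdegrees of its vertices in non-decreasing order. A cycle in a directed graph is consistently oriented if it is a directed cycle. A directed graph $G$ is intrinsically linked as a directed graph if every (tame) embedding of $G$ into $S^3$ contains two vertex-disjoint consistently oriented cycles that form a non-split link. *)

theory Defs
  imports "HOL-Analysis.Analysis" "Graph_Theory.Arc_Walk"
begin

definition tournament :: "('a, 'b) pre_digraph \<Rightarrow> bool" where
  "tournament G \<longleftrightarrow> digraph G \<and>
     (\<forall>u\<in>verts G. \<forall>v\<in>verts G. u \<noteq> v \<longrightarrow>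
        (\<exists>!e. e \<in> arcs G \<and> {tail G e, head G e} = {u, v}))"

definition score_sequence :: "('a, 'b) pre_digraph \<Rightarrow> nat list" where
  "score_sequence G =
     sorted_list_of_multiset (image_mset (out_degree G) (mset_set (verts G)))"

abbreviation S3 :: "(real^4) set" where
  "S3 \<equiv> sphere 0 1"

(* The library's polyhedron is a convex set; this is a (compact) polyhedron in the
   sense of piecewise linear topology. *)
definition pl_polyhedron :: "'n::euclidean_space set \<Rightarrow> bool" where
  "pl_polyhedron X \<longleftrightarrow> (\<exists>F. finite F \<and> (\<forall>P\<in>F. polytope P) \<and> \<Union>F = X)"

(* A proper subset of S3 is tame if some self-homeomorphism of S3 carries it to a
   polyhedron. The piecewise linear structure of S3 is seen through the identification
   of S3 minus a point with R^3: every homeomorphism from S3 minus a point onto R^3 is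
   the restriction of a self-homeomorphism of S3 followed by stereographic projection. *)
definition tame :: "(real^4) set \<Rightarrow> bool" where
  "tame X \<longleftrightarrow>
     (\<exists>q\<in>S3. X \<subseteq> S3 - {q} \<and>
        (\<exists>h k. homeomorphism (S3 - {q}) (UNIV :: (real^3) set) h k \<and> pl_polyhedron (h ` X)))"

definition graph_image ::
  "('a, 'b) pre_digraph \<Rightarrow> ('a \<Rightarrow> real^4) \<Rightarrow> ('b \<Rightarrow> real \<Rightarrow> real^4) \<Rightarrow> (real^4) set" where
  "graph_image G \<phi> \<gamma> = \<phi> ` verts G \<union> (\<Union>e\<in>arcs G. path_image (\<gamma> e))"

(* An embedding of (the geometric realization of) a digraph: points for the vertices and
   a simple path for each arc. Since \<phi> is injective, simple_path means an injective path
   except for loops, which become simple closed curves. *)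
definition embedding_S3 ::
  "('a, 'b) pre_digraph \<Rightarrow> ('a \<Rightarrow> real^4) \<Rightarrow> ('b \<Rightarrow> real \<Rightarrow> real^4) \<Rightarrow> bool" where
  "embedding_S3 G \<phi> \<gamma> \<longleftrightarrow>
     graph_image G \<phi> \<gamma> \<subseteq> S3 \<and>
     inj_on \<phi> (verts G) \<and>
     (\<forall>e\<in>arcs G. simple_path (\<gamma> e) \<and>
        pathstart (\<gamma> e) = \<phi> (tail G e) \<and> pathfinish (\<gamma> e) = \<phi> (head G e) \<and>
        path_image (\<gamma> e) \<inter> \<phi> ` verts G = {\<phi> (tail G e), \<phi> (head G e)}) \<and>
     (\<forall>e\<in>arcs G. \<forall>e'\<in>arcs G. e \<noteq> e' \<longrightarrow>
        path_image (\<gamma> e) \<inter> path_image (\<gamma> e') \<subseteq> \<phi> ` verts G)"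

definition tame_embedding_S3 ::
  "('a, 'b) pre_digraph \<Rightarrow> ('a \<Rightarrow> real^4) \<Rightarrow> ('b \<Rightarrow> real \<Rightarrow> real^4) \<Rightarrow> bool" where
  "tame_embedding_S3 G \<phi> \<gamma> \<longleftrightarrow> embedding_S3 G \<phi> \<gamma> \<and> tame (graph_image G \<phi> \<gamma>)"

definition split_link :: "(real^4) set \<Rightarrow> (real^4) set \<Rightarrow> bool" where
  "split_link K L \<longleftrightarrow>
     (\<exists>S. tame S \<and> S homeomorphic sphere (0 :: real^3) 1 \<and>
        (\<exists>C\<in>components (S3 - S). \<exists>D\<in>components (S3 - S). C \<noteq> D \<and> K \<subseteq> C \<and> L \<subseteq> D))"

definition walk_verts :: "('a, 'b) pre_digraph \<Rightarrow> 'b list \<Rightarrow> 'a set" where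
  "walk_verts G c = tail G ` set c \<union> head G ` set c"

(* pre_digraph.cycle only admits walks that follow the arcs from tail to head, so these
   are exactly the consistently oriented cycles. *)
definition intrinsically_linked_digraph :: "('a, 'b) pre_digraph \<Rightarrow> bool" where
  "intrinsically_linked_digraph G \<longleftrightarrow>
     (\<forall>\<phi> \<gamma>. tame_embedding_S3 G \<phi> \<gamma> \<longrightarrow>
        (\<exists>c d. pre_digraph.cycle G c \<and> pre_digraph.cycle G d \<and>
           walk_verts G c \<inter> walk_verts G d = {} \<and>
           \<not> split_link (\<Union>e\<in>set c. path_image (\<gamma> e)) (\<Union>e\<in>set d. path_image (\<gamma> e))))"

end

theory Submission
  imports Defs
begin

text \<open>
  Split the eight vertices into the four \<open>L\<close> of lowest score and the four \<open>H\<close> of highest score. In all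
  three sequences the scores of \<open>L\<close> add up to 8, and 6 of the arcs counted stay inside \<open>L\<close>, so only two arcs
  lead from \<open>L\<close> to \<open>H\<close>. A directed cycle that visits both parts needs one of them. This leaves so few
  pairs of disjoint directed cycles that a single straight-line drawing keeps all of them
  apart, each pair by a plane of its own.

  The drawing places the vertices on the moment curve \<open>(t, t\<^sup>2, t\<^sup>3)\<close> in three-space and the arcs on straight
  segments. Four points of this curve are never coplanar, so this is an embedding of any tournament.
  A plane meets the curve in the roots of a cubic, and any cubic occurs; hence two sets of points on
  the curve are separated by a plane if they alternate at most three times along it. The segments
  between the points of each set are then separated by the same plane.

  It remains to order the vertices such that disjoint cycles alternate at most three times. The order
  begins with \<open>L\<close>, with the tails of the two arcs in first and third place, and goes on with
  \<open>H\<close>, with the heads of the two arcs at its ends (\<open>eight_points_separated\<close>); if the arcs share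
  an end, an arbitrary vertex takes the place left over. The order of the two
  inner vertices of \<open>H\<close> is chosen so as to exclude one bad pattern, which is possible if no vertex of \<open>H\<close> has score
  greater than 5 (\<open>separable_positions_exist\<close>). In the sequence \<open>(2,2,2,2,4,5,5,6)\<close> there is a vertex of
  score 6, but reversing all arcs turns it into \<open>(1,2,2,3,5,5,5,5)\<close> and keeps the cycles up to
  direction.

  Finally, three-space is the 3-sphere without a point, and sets separated by a plane there are separated
  by the boundary of a convex polytope, which is a tame 2-sphere (\<open>split_link_if_separable\<close>).
\<close>

section \<open>Strongly connected vertex sets in tournaments\<close>

definition tournament_on :: "'a set \<Rightarrow> ('a \<Rightarrow> 'a \<Rightarrow> bool) \<Rightarrow> bool" where
  "tournament_on V R \<longleftrightarrow> (\<forall>x\<in>V. \<forall>y\<in>V. R x y \<longleftrightarrow> x \<noteq> y \<and> \<not> R y x)"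

text \<open>
  Being strongly connected is stated through cuts rather than walks: in this form it is plainly
  invariant under reversing all arcs, and it is applied below to one cut at a time. The bound on the
  cardinality excludes single vertices, which satisfy the cut condition vacuously.
\<close>
definition nontrivially_strong :: "('a \<Rightarrow> 'a \<Rightarrow> bool) \<Rightarrow> 'a set \<Rightarrow> bool" where
  "nontrivially_strong R C \<longleftrightarrow> 1 < card C \<and>
     (\<forall>S\<subseteq>C. S \<noteq> {} \<longrightarrow> S \<noteq> C \<longrightarrow> (\<exists>x\<in>S. \<exists>y\<in>C - S. R x y))"

lemma nontrivially_strong_cut:
  assumes "nontrivially_strong R C" "S \<subseteq> C" "S \<noteq> {}" "S \<noteq> C"
  obtains x y where "x \<in> S" "y \<in> C - S" "R x y"
  using assms unfolding nontrivially_strong_def by blast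

lemma tournament_on_converse: "tournament_on V R\<inverse>\<inverse> \<longleftrightarrow> tournament_on V R"
  unfolding tournament_on_def by auto

lemma nontrivially_strong_converse:
  assumes "nontrivially_strong R C"
  shows "nontrivially_strong R\<inverse>\<inverse> C"
  unfolding nontrivially_strong_def
proof (intro conjI allI impI)
  show "1 < card C" using assms by (simp add: nontrivially_strong_def)
  fix S assume S: "S \<subseteq> C" "S \<noteq> {}" "S \<noteq> C"
  obtain x y where "x \<in> C - S" "y \<in> C - (C - S)" "R x y"
    using nontrivially_strong_cut[OF assms, of "C - S"] S by blast
  then show "\<exists>x\<in>S. \<exists>y\<in>C - S. R\<inverse>\<inverse> x y" by auto
qed

lemma card_nontrivially_strong_ge_3:
  assumes T: "tournament_on V R" and "C \<subseteq> V" and s: "nontrivially_strong R C"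
  shows "3 \<le> card C"
proof (rule ccontr)
  assume "\<not> 3 \<le> card C"
  with s have "card C = 2" by (simp add: nontrivially_strong_def)
  then obtain x y where xy: "C = {x, y}" "x \<noteq> y" by (auto simp: card_2_iff)
  have "R x y" by (rule nontrivially_strong_cut[OF s, of "{x}"]) (use xy in auto)
  moreover have "R y x" by (rule nontrivially_strong_cut[OF s, of "{y}"]) (use xy in auto)
  ultimately show False using T xy \<open>C \<subseteq> V\<close> unfolding tournament_on_def by blast
qed

text \<open>
  Applied to the cut between the two parts: a cycle that visits both parts must use an arc from
  \<open>L\<close> to \<open>H\<close>. Such arcs will be scarce.
\<close>
lemma nontrivially_strong_crossing:
  assumes "nontrivially_strong R C" "C \<subseteq> L \<union> H" "L \<inter> H = {}" "C \<inter> L \<noteq> {}" "C \<inter> H \<noteq> {}"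
  obtains x y where "x \<in> C \<inter> L" "y \<in> C \<inter> H" "R x y"
proof -
  have "C \<inter> L \<noteq> C" using assms(3,5) by blast
  then obtain x y where "x \<in> C \<inter> L" "y \<in> C - C \<inter> L" "R x y"
    using nontrivially_strong_cut[OF assms(1), of "C \<inter> L"] assms(4) by (metis inf_le1)
  then show thesis using that[of x y] assms(2) by blast
qed

lemma tournament_unique_arc:
  assumes "tournament T" "e \<in> arcs T" "e' \<in> arcs T" "{tail T e, head T e} = {tail T e', head T e'}"
  shows "e = e'"
proof -
  interpret digraph T using assms(1) by (simp add: tournament_def)
  have "\<exists>!d. d \<in> arcs T \<and> {tail T d, head T d} = {tail T e, head T e}"
    using assms(1,2) no_loops[OF assms(2)] unfolding tournament_def by simp
  then show ?thesis using assms by metis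
qed

lemma tournament_on_dominates:
  assumes "tournament T"
  shows "tournament_on (verts T) (dominates T)"
proof -
  interpret digraph T using assms by (simp add: tournament_def)
  have "x \<rightarrow>\<^bsub>T\<^esub> y \<longleftrightarrow> x \<noteq> y \<and> \<not> y \<rightarrow>\<^bsub>T\<^esub> x" if "x \<in> verts T" "y \<in> verts T" for x y
  proof (intro iffI conjI notI)
    assume xy: "x \<rightarrow>\<^bsub>T\<^esub> y"
    then show "x = y \<Longrightarrow> False" using adj_not_same by blast
    assume yx: "y \<rightarrow>\<^bsub>T\<^esub> x"
    obtain e where e: "e \<in> arcs T" "tail T e = x" "head T e = y" using xy by blast
    obtain e' where e': "e' \<in> arcs T" "tail T e' = y" "head T e' = x" using yx by blast
    have "e = e'" by (rule tournament_unique_arc[OF assms e(1) e'(1)]) (use e e' in auto)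
    then show False using e e' no_loops[of e] by simp
  next
    assume xy: "x \<noteq> y \<and> \<not> y \<rightarrow>\<^bsub>T\<^esub> x"
    then obtain e where "e \<in> arcs T" "{tail T e, head T e} = {x, y}"
      using assms \<open>x \<in> verts T\<close> \<open>y \<in> verts T\<close> unfolding tournament_def by metis
    then have "(x, y) \<in> arcs_ends T \<or> (y, x) \<in> arcs_ends T"
      by (auto simp: arcs_ends_conv doubleton_eq_iff)
    then show "x \<rightarrow>\<^bsub>T\<^esub> y" using xy by blast
  qed
  then show ?thesis unfolding tournament_on_def by blast
qed

lemma (in wf_digraph) awalk_leaves_set:
  "awalk x p y \<Longrightarrow> x \<in> S \<Longrightarrow> y \<notin> S \<Longrightarrow> \<exists>e\<in>set p. tail G e \<in> S \<and> head G e \<notin> S"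
proof (induction p arbitrary: x)
  case Nil
  then show ?case by (simp add: awalk_Nil_iff)
next
  case (Cons e p)
  then have "tail G e = x" "awalk (head G e) p y" by (simp_all add: awalk_Cons_iff)
  then show ?case using Cons.IH[of "head G e"] Cons.prems(2,3) by auto
qed

text \<open>
  A closed walk that visits \<open>S\<close> but is not contained in it has to leave \<open>S\<close> somewhere. The only
  property of directed cycles used in the combinatorial argument is this one.
\<close>
lemma (in digraph) nontrivially_strong_cycle:
  assumes "cycle c"
  shows "walk_verts G c \<subseteq> verts G" "nontrivially_strong (dominates G) (walk_verts G c)"
proof -
  obtain w where w: "awalk w c w" "c \<noteq> []" using assms by (auto simp: cycle_def)
  have arcs: "set c \<subseteq> arcs G" using w(1) by (simp add: awalk_def)
  then show sub: "walk_verts G c \<subseteq> verts G" by (auto simp: walk_verts_def)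
  have "w \<in> tail G ` set c" using w by (cases c) (auto simp: awalk_Cons_iff)
  then have verts: "walk_verts G c = set (awalk_verts w c)"
    unfolding walk_verts_def using set_awalk_verts[OF w(1)] by auto
  show "nontrivially_strong (dominates G) (walk_verts G c)"
    unfolding nontrivially_strong_def
  proof (intro conjI allI impI)
    obtain e where e: "e \<in> set c" using w(2) by (cases c) auto
    have "card {tail G e, head G e} \<le> card (walk_verts G c)"
      by (rule card_mono) (use e in \<open>auto simp: walk_verts_def\<close>)
    then show "1 < card (walk_verts G c)" using no_loops[of e] e arcs by auto
  next
    fix S assume S: "S \<subseteq> walk_verts G c" "S \<noteq> {}" "S \<noteq> walk_verts G c"
    have "\<exists>e\<in>set c. tail G e \<in> S \<and> head G e \<notin> S"
    proof (cases "w \<in> S")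
      case True
      obtain z where z: "z \<in> set (awalk_verts w c)" "z \<notin> S" using S verts by blast
      obtain q r where "c = q @ r" "awalk w q z" using awalk_decomp[OF w(1) z(1)] by blast
      then show ?thesis using awalk_leaves_set[of w q z S] True z(2) by auto
    next
      case False
      obtain z where z: "z \<in> set (awalk_verts w c)" "z \<in> S" using S verts by blast
      obtain q r where "c = q @ r" "awalk z r w" using awalk_decomp[OF w(1) z(1)] by blast
      then show ?thesis using awalk_leaves_set[of z r w S] False z(2) by auto
    qed
    then obtain e where e: "e \<in> set c" "tail G e \<in> S" "head G e \<notin> S" by blast
    moreover have "head G e \<in> walk_verts G c" using e by (auto simp: walk_verts_def)
    moreover have "tail G e \<rightarrow>\<^bsub>G\<^esub> head G e" using e arcs by (auto simp: arcs_ends_conv)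
    ultimately show "\<exists>x\<in>S. \<exists>y\<in>walk_verts G c - S. x \<rightarrow>\<^bsub>G\<^esub> y" by blast
  qed
qed

section \<open>Planes and the moment curve\<close>

definition strictly_separable :: "'n::euclidean_space set \<Rightarrow> 'n set \<Rightarrow> bool" where
  "strictly_separable A B \<longleftrightarrow> (\<exists>n t. (\<forall>x\<in>A. t < n \<bullet> x) \<and> (\<forall>x\<in>B. n \<bullet> x < t))"

lemma strictly_separable_sym: "strictly_separable A B \<Longrightarrow> strictly_separable B A"
  unfolding strictly_separable_def
  by (metis inner_minus_left neg_less_iff_less)

lemma strictly_separable_subset:
  "strictly_separable A B \<Longrightarrow> A' \<subseteq> A \<Longrightarrow> B' \<subseteq> B \<Longrightarrow> strictly_separable A' B'"
  unfolding strictly_separable_def by blast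

lemma strictly_separable_convex_hull:
  assumes "strictly_separable A B"
  shows "strictly_separable (convex hull A) (convex hull B)"
proof -
  obtain n t where "A \<subseteq> {x. n \<bullet> x > t}" "B \<subseteq> {x. n \<bullet> x < t}"
    using assms unfolding strictly_separable_def by blast
  then have "convex hull A \<subseteq> {x. n \<bullet> x > t}" "convex hull B \<subseteq> {x. n \<bullet> x < t}"
    by (simp_all add: hull_minimal convex_halfspace_gt convex_halfspace_lt)
  then show ?thesis unfolding strictly_separable_def by blast
qed

definition moment_curve :: "real \<Rightarrow> real^3" where
  "moment_curve t = vector [t, t\<^sup>2, t ^ 3]"

lemma inj_moment_curve: "inj moment_curve"
proof (rule injI)
  fix s t assume "moment_curve s = moment_curve t"
  then have "moment_curve s $ 1 = moment_curve t $ 1" by simp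
  then show "s = t" by (simp add: moment_curve_def)
qed

text \<open>
  Affine functionals restrict to the moment curve as polynomials of degree at most three, and every
  cubic with prescribed roots arises. Hence planes meeting the curve in prescribed points are written
  down by their roots.
\<close>
lemma cubic_on_moment_curve:
  obtains n c where "\<And>t. n \<bullet> moment_curve t - c = (t - r\<^sub>1) * (t - r\<^sub>2) * (t - r\<^sub>3)"
proof
  fix t
  show "vector [r\<^sub>1 * r\<^sub>2 + r\<^sub>1 * r\<^sub>3 + r\<^sub>2 * r\<^sub>3, - (r\<^sub>1 + r\<^sub>2 + r\<^sub>3), 1] \<bullet> moment_curve t - r\<^sub>1 * r\<^sub>2 * r\<^sub>3
     = (t - r\<^sub>1) * (t - r\<^sub>2) * (t - r\<^sub>3)"
    unfolding moment_curve_def inner_vec_def sum_3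
    by (simp add: algebra_simps power2_eq_square power3_eq_cube)
qed

text \<open>
  Two sets of points on the curve that alternate at most three times along it can be separated by a
  plane: choose the roots of the cubic in the gaps where the sets alternate. When there are fewer than
  three alternations, the surplus roots are put below all parameters in question.
\<close>
lemma strictly_separable_moment_curve:
  assumes "\<And>x. x \<in> A \<Longrightarrow> 0 < (x - r\<^sub>1) * (x - r\<^sub>2) * (x - r\<^sub>3)"
    and "\<And>x. x \<in> B \<Longrightarrow> (x - r\<^sub>1) * (x - r\<^sub>2) * (x - r\<^sub>3) < 0"
  shows "strictly_separable (moment_curve ` A) (moment_curve ` B)"
proof -
  obtain n c where nc: "\<And>t. n \<bullet> moment_curve t - c = (t - r\<^sub>1) * (t - r\<^sub>2) * (t - r\<^sub>3)"
    by (rule cubic_on_moment_curve[of r\<^sub>1 r\<^sub>2 r\<^sub>3]) blast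
  have "c < n \<bullet> moment_curve x" if "x \<in> A" for x using assms(1)[OF that] nc[of x] by linarith
  moreover have "n \<bullet> moment_curve x < c" if "x \<in> B" for x using assms(2)[OF that] nc[of x] by linarith
  ultimately show ?thesis unfolding strictly_separable_def by blast
qed

text \<open>
  The plane through the points with parameters \<open>b\<close>, \<open>c\<close>, \<open>d\<close> misses the point with parameter
  \<open>a\<close>, so it meets the first segment in its endpoint \<open>b\<close> only, while it contains the second segment.
  The parameters \<open>b\<close>, \<open>c\<close>, \<open>d\<close> may coincide; this covers segments with a common
  endpoint and degenerate segments.
\<close>
lemma moment_curve_segments_meet:
  assumes ab: "x \<in> closed_segment (moment_curve a) (moment_curve b)"
    and cd: "x \<in> closed_segment (moment_curve c) (moment_curve d)"
    and a: "a \<notin> {b, c, d}"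
  shows "x = moment_curve b"
proof -
  obtain n e where Q: "\<And>t. n \<bullet> moment_curve t - e = (t - b) * (t - c) * (t - d)"
    by (rule cubic_on_moment_curve[of b c d]) blast
  have onb: "n \<bullet> moment_curve b = e" and onc: "n \<bullet> moment_curve c = e"
    and ond: "n \<bullet> moment_curve d = e" using Q[of b] Q[of c] Q[of d] by auto
  obtain s where s: "x = (1 - s) *\<^sub>R moment_curve a + s *\<^sub>R moment_curve b"
    using ab by (auto simp: closed_segment_def)
  obtain r where r: "x = (1 - r) *\<^sub>R moment_curve c + r *\<^sub>R moment_curve d"
    using cd by (auto simp: closed_segment_def)
  have "n \<bullet> x = e" unfolding r by (simp add: inner_add_right onc ond algebra_simps)
  moreover have "n \<bullet> x - e = (1 - s) * (n \<bullet> moment_curve a - e)"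
    unfolding s by (simp add: inner_add_right onb algebra_simps)
  ultimately have "(1 - s) * ((a - b) * (a - c) * (a - d)) = 0" unfolding Q by simp
  then have "s = 1" using a by auto
  then show ?thesis unfolding s by simp
qed

text \<open>
  Any four points of the moment curve are affinely independent, so the straight-line drawing of
  any graph with vertices on the curve has no crossings.
\<close>
lemma moment_curve_segments_Int:
  assumes "a \<noteq> b" "c \<noteq> d" "{a, b} \<noteq> {c, d}"
  shows "closed_segment (moment_curve a) (moment_curve b) \<inter>
         closed_segment (moment_curve c) (moment_curve d) \<subseteq> moment_curve ` ({a, b} \<inter> {c, d})"
proof
  fix x assume x: "x \<in> closed_segment (moment_curve a) (moment_curve b) \<inter>
         closed_segment (moment_curve c) (moment_curve d)"
  have *: "a \<notin> {b, c, d} \<Longrightarrow> x = moment_curve b" "b \<notin> {a, c, d} \<Longrightarrow> x = moment_curve a"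
    using moment_curve_segments_meet[of x a b c d] moment_curve_segments_meet[of x b a c d] x
    by (simp_all add: closed_segment_commute)
  consider "a \<notin> {c, d}" "b \<notin> {c, d}" | "a \<notin> {c, d}" "b \<in> {c, d}" | "a \<in> {c, d}" "b \<notin> {c, d}"
    using assms by auto
  then show "x \<in> moment_curve ` ({a, b} \<inter> {c, d})"
  proof cases
    case 1
    then have "moment_curve a = moment_curve b" using * assms(1) by auto
    then show ?thesis using assms(1) inj_moment_curve by (auto dest: injD)
  qed (use * assms(1) in auto)
qed

lemma moment_curve_on_segment:
  assumes "moment_curve c \<in> closed_segment (moment_curve a) (moment_curve b)" "a \<noteq> b"
  shows "c \<in> {a, b}"
proof (rule ccontr)
  assume c: "c \<notin> {a, b}"
  have "moment_curve c \<in> closed_segment (moment_curve c) (moment_curve c)" by simp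
  then have "moment_curve c = moment_curve b"
    using moment_curve_segments_meet[OF assms(1), of c c] assms(2) c by auto
  then show False using inj_moment_curve c by (auto dest: injD)
qed

section \<open>Tame embeddings and split links in the 3-sphere\<close>

lemma punctured_S3_homeomorphic:
  assumes "q \<in> S3"
  obtains h k where "homeomorphism (S3 - {q}) (UNIV :: (real^3) set) h k"
proof -
  have "S3 - {q} homeomorphic (UNIV :: (real^3) set)"
    by (rule homeomorphic_punctured_sphere_affine) (use assms in \<open>auto simp: aff_dim_UNIV\<close>)
  then show ?thesis using that unfolding homeomorphic_def by blast
qed

lemma tame_homeomorphic_image:
  assumes "q \<in> S3" and hom: "homeomorphism (S3 - {q}) (UNIV :: (real^3) set) h k"
    and "pl_polyhedron X"
  shows "tame (k ` X)"
proof -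
  have "h ` k ` X = X" using hom by (auto simp: homeomorphism_def image_iff)
  moreover have "k ` X \<subseteq> S3 - {q}" using hom unfolding homeomorphism_def by blast
  ultimately show ?thesis unfolding tame_def using assms by metis
qed

text \<open>
  The part of a large box on the side of \<open>K\<close> of the separating plane is a convex polytope
  with \<open>K\<close> in its interior and \<open>L\<close> outside. Its boundary, carried to the 3-sphere, is a tame
  2-sphere whose complement is the union of two disjoint connected open sets, one around each of the
  two images.
\<close>
lemma split_link_if_separable:
  assumes q: "q \<in> S3" and hom: "homeomorphism (S3 - {q}) (UNIV :: (real^3) set) h k"
    and K: "bounded K" "K \<noteq> {}" and sep: "strictly_separable K L"
  shows "split_link (k ` K) (k ` L)"
proof -
  obtain n t where nK: "\<And>x. x \<in> K \<Longrightarrow> t < n \<bullet> x" and nL: "\<And>x. x \<in> L \<Longrightarrow> n \<bullet> x < t"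
    using sep by (auto simp: strictly_separable_def)
  obtain r where r: "K \<subseteq> box (-r) r" using bounded_subset_box_symmetric[OF K(1)] by blast
  define P where "P = cbox (-r) r \<inter> {x. n \<bullet> x \<ge> t}"
  have P: "polytope P" unfolding P_def
    by (intro polytope_Int_polyhedron polytope_interval polyhedron_halfspace_ge)
  have KP: "K \<subseteq> interior P"
  proof -
    have "K \<subseteq> box (-r) r \<inter> {x. n \<bullet> x > t}" using r nK by auto
    also have "\<dots> \<subseteq> interior P"
      by (rule interior_maximal) (auto simp: P_def open_halfspace_gt box_subset_cbox[THEN subsetD])
    finally show ?thesis .
  qed
  have LP: "L \<subseteq> - P" using nL by (force simp: P_def)
  have intP: "interior P \<noteq> {}" using KP K by auto
  have compP: "compact P" and convP: "convex P" and bndP: "bounded P"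
    using P by (simp_all add: polytope_imp_compact polytope_imp_convex polytope_imp_bounded)
  have hom': "homeomorphism UNIV (S3 - {q}) k h" using hom by (simp add: homeomorphism_symD)
  have contk: "continuous_on X k" for X
    using hom' by (meson continuous_on_subset homeomorphism_cont1 subset_UNIV)
  have imk: "k ` UNIV = S3 - {q}" using hom' by (simp add: homeomorphism_def)
  have injk: "inj k" using hom' by (metis UNIV_I homeomorphism_apply1 injI)
  let ?S = "k ` frontier P" and ?U = "k ` interior P" and ?W = "S3 - k ` P"
  have "tame ?S"
  proof (rule tame_homeomorphic_image[OF q hom])
    have "frontier P = \<Union> {F. F facet_of P}"
      using rel_frontier_of_polyhedron[OF polytope_imp_polyhedron[OF P]]
        rel_frontier_nonempty_interior[OF intP] by simp
    moreover have "\<forall>F\<in>{F. F facet_of P}. polytope F"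
      using face_of_polytope_polytope[OF P] by (auto simp: facet_of_def)
    ultimately show "pl_polyhedron (frontier P)"
      unfolding pl_polyhedron_def using finite_polytope_facets[OF P] by metis
  qed
  have "rel_frontier P homeomorphic rel_frontier (cball (0 :: real^3) 1)"
    by (rule homeomorphic_rel_frontiers_convex_bounded_sets)
      (use convP bndP intP in \<open>auto simp: aff_dim_nonempty_interior aff_dim_cball\<close>)
  then have "frontier P homeomorphic sphere (0 :: real^3) 1"
    using rel_frontier_nonempty_interior[OF intP] by simp
  moreover have "homeomorphism (frontier P) ?S k h"
    by (rule homeomorphism_of_subsets[OF hom', where T'' = "{}"]) simp_all
  ultimately have sphS: "?S homeomorphic sphere (0 :: real^3) 1"
    by (meson homeomorphic_def homeomorphic_sym homeomorphic_trans)
  have split: "S3 - ?S = ?U \<union> ?W" "?U \<inter> ?W = {}"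
  proof -
    have "P = interior P \<union> frontier P" "interior P \<inter> frontier P = {}"
      using compP by (auto simp: frontier_def compact_imp_closed interior_subset[THEN subsetD])
    then have *: "k ` P = ?U \<union> ?S" "?U \<inter> ?S = {}"
      using injk by (metis image_Un, metis image_Int image_empty)
    moreover have "k ` P \<subseteq> S3" using imk by blast
    ultimately show "S3 - ?S = ?U \<union> ?W" "?U \<inter> ?W = {}" by blast+
  qed
  have connU: "connected ?U"
    by (intro connected_continuous_image contk convex_connected convex_interior convP)
  have clkP: "closed (k ` P)" by (intro compact_imp_closed compact_continuous_image contk compP)
  have imPc: "k ` (- P) = S3 - {q} - k ` P"
    by (simp only: Compl_eq_Diff_UNIV image_set_diff[OF injk] imk)
  (* Adding the missing point q keeps the exterior connected, because q is a limit point of it. *)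
  have connW: "connected ?W"
  proof (rule connected_intermediate_closure)
    show "connected (k ` (- P))"
      by (intro connected_continuous_image contk connected_complement_bounded_convex bndP convP) simp
    then show "k ` (- P) \<subseteq> ?W" using imPc by blast
    have "q islimpt S3"
    proof (rule connected_imp_perfect)
      show "connected S3" by (simp add: connected_sphere_eq)
      show "q \<in> S3" by (rule q)
      show "S3 \<noteq> {x}" for x
      proof
        assume "S3 = {x}"
        then have "k 0 = x" "k 1 = x" using imk by blast+
        then show False using injk by (metis injD zero_neq_one)
      qed
    qed
    moreover have "q \<notin> k ` P" using imk by blast
    ultimately have "q islimpt (S3 \<inter> - k ` P)"
      using clkP by (metis ComplI islimpt_Int_eventually eventually_at_topological open_Compl)
    then have "q islimpt k ` (- P)"
      by (rule islimpt_subset[OF iffD1[OF islimpt_punctured]]) (use imPc in auto)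
    then have "q \<in> closure (k ` (- P))" by (simp add: closure_def)
    then show "?W \<subseteq> closure (k ` (- P))" using imPc closure_subset by blast
  qed
  have LW: "k ` L \<subseteq> ?W" using LP imPc by blast
  have q': "q \<in> ?W" using q imk by blast
  have sub: "?U \<subseteq> S3 - ?S" "?W \<subseteq> S3 - ?S" "S3 - ?S \<noteq> {}"
    unfolding split(1) using q' by blast+
  obtain C where C: "C \<in> components (S3 - ?S)" "?U \<subseteq> C"
    using exists_component_superset[OF sub(1,3) connU] by blast
  obtain D where D: "D \<in> components (S3 - ?S)" "?W \<subseteq> D"
    using exists_component_superset[OF sub(2,3) connW] by blast
  have "C \<noteq> D"
  proof
    assume "C = D"
    then have "S3 - ?S = C"
      using C(2) D(2) split(1) in_components_subset[OF C(1)] by (metis Un_least subset_antisym)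
    then have conn: "connected (S3 - ?S)" using in_components_connected[OF C(1)] by simp
    have "openin (top_of_set (S3 - {q})) ?U"
      by (rule homeomorphism_imp_open_map[OF hom']) simp
    moreover have "openin (top_of_set S3) (S3 - {q})" by (simp add: openin_delete)
    ultimately have "openin (top_of_set S3) ?U" by (rule openin_trans)
    then have 1: "openin (top_of_set (S3 - ?S)) ?U"
      by (rule openin_subset_trans) (use sub in auto)
    have "openin (top_of_set S3) ?W"
      using openin_open_Int[of "- k ` P" S3] clkP by (simp add: open_Compl Diff_eq)
    then have 2: "openin (top_of_set (S3 - ?S)) ?W"
      by (rule openin_subset_trans) (use sub in auto)
    have "?U \<noteq> {}" "?W \<noteq> {}" "S3 - ?S \<subseteq> ?U \<union> ?W" using intP q' split(1) by blast+
    then show False using conn 1 2 split(2) unfolding connected_openin by metis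
  qed
  moreover have "k ` K \<subseteq> C" using KP C(2) by blast
  moreover have "k ` L \<subseteq> D" using LW D(2) by blast
  ultimately show ?thesis unfolding split_link_def using \<open>tame ?S\<close> sphS C(1) D(1) by blast
qed

lemma tame_embedding_moment_curve:
  fixes p :: "'a \<Rightarrow> real" and T :: "('a, 'b) pre_digraph"
  assumes T: "tournament T" and p: "inj_on p (verts T)"
    and q: "q \<in> S3" and hom: "homeomorphism (S3 - {q}) (UNIV :: (real^3) set) h k"
  shows "tame_embedding_S3 T (k \<circ> (moment_curve \<circ> p))
    (\<lambda>e. k \<circ> linepath (moment_curve (p (tail T e))) (moment_curve (p (head T e))))"
    (is "tame_embedding_S3 T ?\<phi> ?\<gamma>")
proof -
  interpret digraph T using T by (simp add: tournament_def)
  have hom': "homeomorphism UNIV (S3 - {q}) k h" using hom by (simp add: homeomorphism_symD)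
  have contk: "continuous_on X k" for X
    using hom' by (meson continuous_on_subset homeomorphism_cont1 subset_UNIV)
  have imk: "k ` UNIV = S3 - {q}" using hom' by (simp add: homeomorphism_def)
  have injk: "inj k" using hom' by (metis UNIV_I homeomorphism_apply1 injI)
  define seg where
    "seg e = closed_segment (moment_curve (p (tail T e))) (moment_curve (p (head T e)))" for e
  have im: "path_image (?\<gamma> e) = k ` seg e" for e
    by (simp add: path_image_compose seg_def)
  have pe: "p (tail T e) \<noteq> p (head T e)" if "e \<in> arcs T" for e
    using p no_loops[OF that] that by (auto dest: inj_onD)
  let ?X = "(moment_curve \<circ> p) ` verts T \<union> (\<Union>e\<in>arcs T. seg e)"
  have graph: "graph_image T ?\<phi> ?\<gamma> = k ` ?X"
    unfolding graph_image_def im by (simp add: image_Un image_UN image_comp)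
  have "pl_polyhedron ?X"
    unfolding pl_polyhedron_def
  proof (intro exI conjI)
    let ?F = "(\<lambda>v. {(moment_curve \<circ> p) v}) ` verts T \<union> seg ` arcs T"
    show "finite ?F" by simp
    show "\<forall>P\<in>?F. polytope P"
      by (auto simp: seg_def segment_convex_hull polytope_convex_hull polytope_sing)
    show "\<Union> ?F = ?X" by auto
  qed
  then have "tame (graph_image T ?\<phi> ?\<gamma>)"
    unfolding graph by (rule tame_homeomorphic_image[OF q hom])
  moreover have "embedding_S3 T ?\<phi> ?\<gamma>"
    unfolding embedding_S3_def
  proof (intro conjI ballI impI)
    show "graph_image T ?\<phi> ?\<gamma> \<subseteq> S3" unfolding graph using imk by blast
    show "inj_on ?\<phi> (verts T)"
      by (intro comp_inj_on p inj_on_subset[OF inj_moment_curve] inj_on_subset[OF injk]) auto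
  next
    fix e assume e: "e \<in> arcs T"
    have ne: "moment_curve (p (tail T e)) \<noteq> moment_curve (p (head T e))"
      using pe[OF e] inj_moment_curve by (auto dest: injD)
    show "simple_path (?\<gamma> e)"
      by (intro simple_path_continuous_image simple_path_linepath ne contk inj_on_subset[OF injk]) auto
    show "pathstart (?\<gamma> e) = ?\<phi> (tail T e)" "pathfinish (?\<gamma> e) = ?\<phi> (head T e)"
      by (simp_all add: pathstart_compose pathfinish_compose)
    have "seg e \<inter> (moment_curve \<circ> p) ` verts T =
        {(moment_curve \<circ> p) (tail T e), (moment_curve \<circ> p) (head T e)}"
    proof (intro equalityI subsetI)
      fix x assume "x \<in> seg e \<inter> (moment_curve \<circ> p) ` verts T"
      then obtain v where v: "x = moment_curve (p v)" "x \<in> seg e" by auto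
      then have "p v \<in> {p (tail T e), p (head T e)}"
        using moment_curve_on_segment[OF _ pe[OF e]] by (simp add: seg_def)
      then show "x \<in> {(moment_curve \<circ> p) (tail T e), (moment_curve \<circ> p) (head T e)}" using v by auto
    qed (use e in \<open>auto simp: seg_def\<close>)
    then show "path_image (?\<gamma> e) \<inter> ?\<phi> ` verts T = {?\<phi> (tail T e), ?\<phi> (head T e)}"
      unfolding im image_comp[symmetric] image_Int[OF injk, symmetric] by simp
  next
    fix e e' assume e: "e \<in> arcs T" "e' \<in> arcs T" "e \<noteq> e'"
    have "{p (tail T e), p (head T e)} \<noteq> {p (tail T e'), p (head T e')}"
    proof
      assume "{p (tail T e), p (head T e)} = {p (tail T e'), p (head T e')}"
      then have "p ` {tail T e, head T e} = p ` {tail T e', head T e'}" by simp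
      then have "{tail T e, head T e} = {tail T e', head T e'}"
        using inj_on_image_eq_iff[OF p, of "{tail T e, head T e}" "{tail T e', head T e'}"] e
        by auto
      then show False using tournament_unique_arc[OF T e(1,2)] e(3) by blast
    qed
    then have "seg e \<inter> seg e' \<subseteq> moment_curve ` {p (tail T e), p (head T e)}"
      unfolding seg_def using moment_curve_segments_Int[OF pe[OF e(1)] pe[OF e(2)]] by blast
    also have "\<dots> \<subseteq> (moment_curve \<circ> p) ` verts T" using e by auto
    finally show "path_image (?\<gamma> e) \<inter> path_image (?\<gamma> e') \<subseteq> ?\<phi> ` verts T"
      unfolding im image_comp[symmetric] image_Int[OF injk, symmetric] by (rule image_mono)
  qed
  ultimately show ?thesis unfolding tame_embedding_S3_def by blast
qed

text \<open>
  Separation is asked of all strongly connected sets and not just of the vertex sets of directed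
  cycles: the combinatorial argument gives this stronger property, which refers only to a relation.
\<close>
definition cycle_separating :: "'a set \<Rightarrow> ('a \<Rightarrow> 'a \<Rightarrow> bool) \<Rightarrow> ('a \<Rightarrow> real) \<Rightarrow> bool" where
  "cycle_separating V R p \<longleftrightarrow> inj_on p V \<and>
     (\<forall>C D. C \<subseteq> V \<longrightarrow> D \<subseteq> V \<longrightarrow> C \<inter> D = {} \<longrightarrow>
        nontrivially_strong R C \<longrightarrow> nontrivially_strong R D \<longrightarrow>
        strictly_separable ((moment_curve \<circ> p) ` C) ((moment_curve \<circ> p) ` D))"

text \<open>
  Reversing all arcs changes neither the strongly connected sets nor the points; this reduces the
  score sequence \<open>(2,2,2,2,4,5,5,6)\<close> to \<open>(1,2,2,3,5,5,5,5)\<close>.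
\<close>
lemma cycle_separating_converse:
  assumes "cycle_separating V R\<inverse>\<inverse> p"
  shows "cycle_separating V R p"
  using assms nontrivially_strong_converse[of R] unfolding cycle_separating_def by simp

lemma not_intrinsically_linked_if_separable:
  fixes p :: "'a \<Rightarrow> real" and T :: "('a, 'b) pre_digraph"
  assumes T: "tournament T" and cs: "cycle_separating (verts T) (dominates T) p"
  shows "\<not> intrinsically_linked_digraph T"
proof
  assume linked: "intrinsically_linked_digraph T"
  have p: "inj_on p (verts T)" using cs by (simp add: cycle_separating_def)
  interpret digraph T using T by (simp add: tournament_def)
  obtain q :: "real^4" where q: "q \<in> S3" using vector_choose_size[of 1] by auto
  obtain h k where hom: "homeomorphism (S3 - {q}) (UNIV :: (real^3) set) h k"
    using punctured_S3_homeomorphic[OF q] by blast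
  let ?\<gamma> = "\<lambda>e. k \<circ> linepath (moment_curve (p (tail T e))) (moment_curve (p (head T e)))"
  obtain c d where cd: "cycle c" "cycle d" "walk_verts T c \<inter> walk_verts T d = {}"
    and ns: "\<not> split_link (\<Union>e\<in>set c. path_image (?\<gamma> e)) (\<Union>e\<in>set d. path_image (?\<gamma> e))"
    using linked tame_embedding_moment_curve[OF T p q hom] unfolding intrinsically_linked_digraph_def
    by blast
  define poly where "poly c = (\<Union>e\<in>set c.
    closed_segment (moment_curve (p (tail T e))) (moment_curve (p (head T e))))" for c
  have im: "(\<Union>e\<in>set c. path_image (?\<gamma> e)) = k ` poly c" for c
    unfolding poly_def by (simp add: path_image_compose image_UN)
  have hull: "poly c \<subseteq> convex hull ((moment_curve \<circ> p) ` walk_verts T c)" for c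
    unfolding poly_def segment_convex_hull
    by (intro UN_least hull_mono) (auto simp: walk_verts_def)
  have "strictly_separable ((moment_curve \<circ> p) ` walk_verts T c) ((moment_curve \<circ> p) ` walk_verts T d)"
    using cs nontrivially_strong_cycle cd unfolding cycle_separating_def by simp
  then have "strictly_separable (poly c) (poly d)"
    by (rule strictly_separable_subset[OF strictly_separable_convex_hull hull hull])
  moreover have "bounded (poly c)" unfolding poly_def by (intro bounded_UN) (auto simp: bounded_closed_segment)
  moreover have "poly c \<noteq> {}" using cd(1) unfolding poly_def cycle_def by auto
  ultimately have "split_link (k ` poly c) (k ` poly d)"
    using split_link_if_separable[OF q hom] by blast
  with ns show False unfolding im by blast
qed

section \<open>Placing eight vertices on the moment curve\<close>

text \<open>
  Disjoint cycles alternate at most three times in the order \<open>a, m, b, n, a', u, v, b'\<close>, for the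
  following reasons. Call the first four vertices \<open>L\<close> and the last four \<open>H\<close>.

  If one cycle lies in \<open>L\<close> or in \<open>H\<close>, it occupies at least three of the four vertices there.
  The other cycle then either lies in the other part or keeps a single vertex in this part, and that
  vertex is an end of an arc from \<open>L\<close> to \<open>H\<close>, hence one of \<open>a\<close>, \<open>b\<close>, \<open>a'\<close>, \<open>b'\<close>.
  The worst of these cases is \<open>b\<close>, with three alternations.

  If both cycles visit both parts, then one contains \<open>a, a'\<close> and the other \<open>b, b'\<close>. There is one
  alternation between \<open>a\<close> and \<open>b\<close> and one between \<open>b\<close> and \<open>a'\<close>, wherever \<open>m\<close> and \<open>n\<close> belong, and
  one between \<open>a'\<close> and \<open>b'\<close> unless \<open>u\<close> is on the cycle through \<open>b'\<close> and \<open>v\<close> on the one through \<open>a'\<close>.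
  In that exceptional case \<open>v\<close> could only be entered from \<open>a'\<close>, and \<open>u\<close> only from \<open>b'\<close>; the last
  condition on the arcs excludes that both are possible.
\<close>
lemma eight_points_separated:
  fixes p :: "'a \<Rightarrow> real"
  assumes T: "tournament_on V R"
    and V: "V = {a, m, b, n, a', u, v, b'}" and dist: "distinct [a, m, b, n, a', u, v, b']"
    and p: "map p [a, m, b, n, a', u, v, b'] = [0, 1, 2, 3, 4, 5, 6, 7]"
    and up: "\<And>x y. x \<in> {a, m, b, n} \<Longrightarrow> y \<in> {a', u, v, b'} \<Longrightarrow> R x y \<Longrightarrow> x \<in> {a, b} \<and> y \<in> {a', b'}"
    and disj: "\<And>x y x' y'. x \<in> {a, m, b, n} \<Longrightarrow> y \<in> {a', u, v, b'} \<Longrightarrow> R x y \<Longrightarrow>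
       x' \<in> {a, m, b, n} \<Longrightarrow> y' \<in> {a', u, v, b'} \<Longrightarrow> R x' y' \<Longrightarrow> x \<noteq> x' \<Longrightarrow> y \<noteq> y' \<Longrightarrow>
       {(x, y), (x', y')} = {(a, a'), (b, b')} \<and> \<not> (R a' v \<and> R b' u)"
    and C: "C \<subseteq> V" "nontrivially_strong R C" and D: "D \<subseteq> V" "nontrivially_strong R D"
    and CD: "C \<inter> D = {}"
  shows "strictly_separable ((moment_curve \<circ> p) ` C) ((moment_curve \<circ> p) ` D)"
proof -
  let ?L = "{a, m, b, n}" and ?H = "{a', u, v, b'}"
  have pv: "p a = 0" "p m = 1" "p b = 2" "p n = 3" "p a' = 4" "p u = 5" "p v = 6" "p b' = 7"
    using p by auto
  have LH: "V = ?L \<union> ?H" "?L \<inter> ?H = {}" "card ?L = 4" "card ?H = 4" "finite ?L" "finite ?H"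
    using V dist by auto
  have sep: "strictly_separable ((moment_curve \<circ> p) ` X) ((moment_curve \<circ> p) ` Y)"
    if "X \<subseteq> X'" "Y \<subseteq> Y'"
      and "\<forall>x\<in>X'. 0 < (p x - r\<^sub>1) * (p x - r\<^sub>2) * (p x - r\<^sub>3)"
      and "\<forall>x\<in>Y'. (p x - r\<^sub>1) * (p x - r\<^sub>2) * (p x - r\<^sub>3) < 0" for X Y X' Y' r\<^sub>1 r\<^sub>2 r\<^sub>3
    unfolding image_comp[symmetric]
    by (rule strictly_separable_moment_curve[of _ r\<^sub>1 r\<^sub>2 r\<^sub>3]) (use that in blast)+
  have inside: "strictly_separable ((moment_curve \<circ> p) ` X) ((moment_curve \<circ> p) ` Y)"
    if X: "X \<subseteq> V" "nontrivially_strong R X" and Y: "Y \<subseteq> V" "nontrivially_strong R Y"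
      and XY: "X \<inter> Y = {}" and sub: "X \<subseteq> ?L \<or> X \<subseteq> ?H" for X Y
  proof -
    have X3: "3 \<le> card X" and Y3: "3 \<le> card Y"
      using card_nontrivially_strong_ge_3[OF T] X Y by auto
    (* X fills all of its part except for at most one vertex. *)
    have small: "card (Y \<inter> K) \<le> 1 \<and> (\<forall>z. Y \<inter> K = {z} \<longrightarrow> X = K - {z})"
      if K: "card K = 4" "finite K" "X \<subseteq> K" for K
    proof -
      have "card (Y \<inter> K) + card X = card (Y \<inter> K \<union> X)"
        using K XY by (intro card_Un_disjoint[symmetric]) (auto intro: finite_subset)
      also have "\<dots> \<le> card K" using K by (intro card_mono) auto
      finally have 1: "card (Y \<inter> K) + card X \<le> 4" using K by simp
      have "X = K - {z}" if z: "Y \<inter> K = {z}" for z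
      proof (rule card_subset_eq)
        show "finite (K - {z})" using K by simp
        show "X \<subseteq> K - {z}" using z K XY by auto
        have "z \<in> K" using z by auto
        then show "card X = card (K - {z})" using 1 X3 z K by simp
      qed
      with 1 X3 show ?thesis by auto
    qed
    have notin: "\<not> Y \<subseteq> K" if "card K = 4" "finite K" "X \<subseteq> K" for K
      using small[OF that] Y3 by (metis Int_absorb2 le_trans numeral_le_one_iff semiring_norm(70))
    show ?thesis
    proof (cases "X \<subseteq> ?L")
      case True
      then have YH: "Y \<inter> ?H \<noteq> {}" using notin[OF LH(3,5)] Y LH by blast
      show ?thesis
      proof (cases "Y \<inter> ?L = {}")
        case True
        then have Y': "Y \<subseteq> ?H" using Y LH by blast
        show ?thesis
          by (rule strictly_separable_sym, rule sep[OF Y' \<open>X \<subseteq> ?L\<close>, of "7/2" "-1" "-1"])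
            (simp_all add: pv)
      next
        case False
        then have "card (Y \<inter> ?L) = 1" using small[OF LH(3,5) \<open>X \<subseteq> ?L\<close>] LH(5)
          by (metis card_0_eq finite_Int le_neq_implies_less less_one)
        then obtain z where z: "Y \<inter> ?L = {z}" by (auto simp: card_1_singleton_iff)
        obtain x y where "x \<in> Y \<inter> ?L" "y \<in> Y \<inter> ?H" "R x y"
          using nontrivially_strong_crossing[OF Y(2) _ LH(2) False YH] Y(1) LH(1) by blast
        then have zab: "z \<in> {a, b}" using up[of x y] z by auto
        have X': "X = ?L - {z}" using small[OF LH(3,5) \<open>X \<subseteq> ?L\<close>] z by simp
        have Y': "Y \<subseteq> insert z ?H" using z Y LH by blast
        consider "z = a" | "z = b" using zab by auto
        then show ?thesis
        proof cases
          case 1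
          have "X \<subseteq> {m, b, n}" "Y \<subseteq> insert a ?H" using X' Y' 1 by blast+
          then show ?thesis
            by (intro strictly_separable_sym[OF sep[of Y _ X _ "1/2" "7/2" "-1"]])
              (assumption | simp add: pv)+
        next
          case 2
          have "X \<subseteq> {a, m, n}" "Y \<subseteq> insert b ?H" using X' Y' 2 by blast+
          then show ?thesis
            by (intro strictly_separable_sym[OF sep[of Y _ X _ "3/2" "5/2" "7/2"]])
              (assumption | simp add: pv)+
        qed
      qed
    next
      case False
      then have XH: "X \<subseteq> ?H" using sub by simp
      then have YL: "Y \<inter> ?L \<noteq> {}" using notin[OF LH(4,6)] Y LH by blast
      show ?thesis
      proof (cases "Y \<inter> ?H = {}")
        case True
        then have Y': "Y \<subseteq> ?L" using Y LH by blast
        show ?thesis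
          by (rule sep[OF XH Y', of "7/2" "-1" "-1"]) (simp_all add: pv)
      next
        case False
        then have "card (Y \<inter> ?H) = 1" using small[OF LH(4,6) XH] LH(6)
          by (metis card_0_eq finite_Int le_neq_implies_less less_one)
        then obtain z where z: "Y \<inter> ?H = {z}" by (auto simp: card_1_singleton_iff)
        obtain x y where "x \<in> Y \<inter> ?L" "y \<in> Y \<inter> ?H" "R x y"
          using nontrivially_strong_crossing[OF Y(2) _ LH(2) YL False] Y(1) LH(1) by blast
        then have zab: "z \<in> {a', b'}" using up[of x y] z by auto
        have X': "X = ?H - {z}" using small[OF LH(4,6) XH] z by simp
        have Y': "Y \<subseteq> insert z ?L" using z Y LH by blast
        consider "z = a'" | "z = b'" using zab by auto
        then show ?thesis
        proof cases
          case 1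
          have "X \<subseteq> {u, v, b'}" "Y \<subseteq> insert a' ?L" using X' Y' 1 by blast+
          then show ?thesis
            by (intro sep[of X _ Y _ "9/2" "-1" "-1"]) (assumption | simp add: pv)+
        next
          case 2
          have "X \<subseteq> {a', u, v}" "Y \<subseteq> insert b' ?L" using X' Y' 2 by blast+
          then show ?thesis
            by (intro strictly_separable_sym[OF sep[of Y _ X _ "7/2" "13/2" "-1"]])
              (assumption | simp add: pv)+
        qed
      qed
    qed
  qed
  have crossing: "strictly_separable ((moment_curve \<circ> p) ` X) ((moment_curve \<circ> p) ` Y)"
    if X: "X \<subseteq> V" "nontrivially_strong R X" and Y: "Y \<subseteq> V" "nontrivially_strong R Y"
      and XY: "X \<inter> Y = {}" and ends: "a \<in> X" "a' \<in> X" "b \<in> Y" "b' \<in> Y"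
      and nR: "\<not> (R a' v \<and> R b' u)" for X Y
  proof -
    have into_H: "R y z"
      if Z: "Z \<subseteq> V" "nontrivially_strong R Z" "Z \<inter> ?H = {y, z}" "z \<in> {u, v}" for Z y z
    proof -
      have "z \<in> Z" using Z by auto
      have "Z - {z} \<noteq> {}" using Z(2) by (auto simp: nontrivially_strong_def dest: subset_singletonD)
      then obtain w where w: "w \<in> Z - {z}" "R w z"
        using nontrivially_strong_cut[OF Z(2), of "Z - {z}"] \<open>z \<in> Z\<close> by blast
      have "w \<notin> ?L" using up[of w z] w Z(4) dist by auto
      then have "w \<in> Z \<inter> ?H" using w Z(1) LH(1) by blast
      then show ?thesis using Z(3) w by auto
    qed
    have uv: "v \<notin> X" if "u \<in> Y"
    proof
      assume "v \<in> X"
      have "X \<inter> ?H = {a', v}" "Y \<inter> ?H = {b', u}" using ends XY that \<open>v \<in> X\<close> by auto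
      then have "R a' v" "R b' u" using into_H X Y by auto
      with nR show False by simp
    qed
    (* The three cuts fall inside the gaps between a and b, between b and a', and between a' and b'. *)
    define r\<^sub>1 :: real where "r\<^sub>1 = (if m \<in> Y then 1/2 else 3/2)"
    define r\<^sub>2 :: real where "r\<^sub>2 = (if n \<in> Y then 7/2 else 5/2)"
    define r\<^sub>3 :: real where "r\<^sub>3 = (if u \<in> Y then 9/2 else if v \<in> Y then 11/2 else 13/2)"
    show ?thesis
    proof (rule strictly_separable_sym, rule sep[of Y Y X X r\<^sub>1 r\<^sub>2 r\<^sub>3, OF order.refl order.refl])
      show "\<forall>x\<in>Y. 0 < (p x - r\<^sub>1) * (p x - r\<^sub>2) * (p x - r\<^sub>3)"
      proof
        fix x assume x: "x \<in> Y"
        then have "x \<noteq> a" "x \<noteq> a'" using XY ends by blast+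
        then consider "x = m" | "x = b" | "x = n" | "x = u" | "x = v" | "x = b'"
          using x Y(1) V by blast
        then show "0 < (p x - r\<^sub>1) * (p x - r\<^sub>2) * (p x - r\<^sub>3)"
          by cases (use x in \<open>simp_all add: pv r\<^sub>1_def r\<^sub>2_def r\<^sub>3_def\<close>)
      qed
      show "\<forall>x\<in>X. (p x - r\<^sub>1) * (p x - r\<^sub>2) * (p x - r\<^sub>3) < 0"
      proof
        fix x assume x: "x \<in> X"
        then have nY: "x \<notin> Y" using XY by blast
        then have "x \<noteq> b" "x \<noteq> b'" using ends by blast+
        then consider "x = a" | "x = m" | "x = n" | "x = a'" | "x = u" | "x = v"
          using x X(1) V by blast
        then show "(p x - r\<^sub>1) * (p x - r\<^sub>2) * (p x - r\<^sub>3) < 0"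
          by cases (use x nY uv in \<open>auto simp: pv r\<^sub>1_def r\<^sub>2_def r\<^sub>3_def\<close>)
      qed
    qed
  qed
  consider "C \<subseteq> ?L \<or> C \<subseteq> ?H" | "D \<subseteq> ?L \<or> D \<subseteq> ?H"
    | "C \<inter> ?L \<noteq> {}" "C \<inter> ?H \<noteq> {}" "D \<inter> ?L \<noteq> {}" "D \<inter> ?H \<noteq> {}"
    using C(1) D(1) LH(1) by blast
  then show ?thesis
  proof cases
    case 1
    then show ?thesis using inside C D CD by blast
  next
    case 2
    then show ?thesis using inside[OF D C _ 2] CD strictly_separable_sym by blast
  next
    case 3
    obtain x y where xy: "x \<in> C \<inter> ?L" "y \<in> C \<inter> ?H" "R x y"
      using nontrivially_strong_crossing[OF C(2) _ LH(2) 3(1,2)] C(1) LH(1) by blast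
    obtain x' y' where xy': "x' \<in> D \<inter> ?L" "y' \<in> D \<inter> ?H" "R x' y'"
      using nontrivially_strong_crossing[OF D(2) _ LH(2) 3(3,4)] D(1) LH(1) by blast
    have ne: "x \<noteq> x'" "y \<noteq> y'" using xy xy' CD by auto
    have *: "{(x, y), (x', y')} = {(a, a'), (b, b')}" "\<not> (R a' v \<and> R b' u)"
      using disj[of x y x' y'] xy xy' ne by auto
    then consider "(x, y) = (a, a')" "(x', y') = (b, b')" | "(x, y) = (b, b')" "(x', y') = (a, a')"
      by (auto simp: doubleton_eq_iff)
    then show ?thesis
    proof cases
      case 1
      then show ?thesis using crossing[OF C D CD] xy xy' *(2) by auto
    next
      case 2
      then have "strictly_separable ((moment_curve \<circ> p) ` D) ((moment_curve \<circ> p) ` C)"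
        using crossing[OF D C] CD xy xy' *(2) by auto
      then show ?thesis by (rule strictly_separable_sym)
    qed
  qed
qed

lemma card_tournament_arcs:
  assumes T: "tournament_on L R" and fin: "finite L"
  shows "2 * card (SIGMA x:L. {y \<in> L. R x y}) = card L * (card L - 1)"
proof -
  let ?A = "SIGMA x:L. {y \<in> L. R x y}"
  have finA: "finite ?A" using fin by simp
  have "card (?A\<inverse>) = card ?A" by (rule card_inverse)
  moreover have "?A \<inter> ?A\<inverse> = {}" using T unfolding tournament_on_def by blast
  moreover have "?A \<union> ?A\<inverse> = L \<times> L - (\<lambda>x. (x, x)) ` L" using T unfolding tournament_on_def by blast
  ultimately have "2 * card ?A = card (L \<times> L - (\<lambda>x. (x, x)) ` L)"
    using card_Un_disjoint[OF finA, of "?A\<inverse>"] finA by simp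
  also have "\<dots> = card (L \<times> L) - card ((\<lambda>x. (x, x)) ` L)"
    using fin by (intro card_Diff_subset) auto
  also have "\<dots> = card L * card L - card L"
    by (simp add: card_cartesian_product card_image inj_on_def)
  finally show ?thesis by (simp add: diff_mult_distrib2)
qed

text \<open>
  The sum of the scores over a set counts the arcs inside it, whose number is the same for all
  tournaments, and the arcs leaving it. So the four vertices of low score, with total score 8, have
  exactly two arcs to the other four vertices.
\<close>
lemma card_arcs_out_of_set:
  assumes T: "tournament_on V R" and V: "V = L \<union> H" "L \<inter> H = {}" "finite V"
  shows "2 * (\<Sum>x\<in>L. card {y \<in> V. R x y}) =
    card L * (card L - 1) + 2 * card {(x, y). x \<in> L \<and> y \<in> H \<and> R x y}"
proof -
  have fin: "finite L" "finite H" using V by auto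
  have TL: "tournament_on L R" using T V(1) unfolding tournament_on_def by blast
  have eq: "{y \<in> V. R x y} = {y \<in> L. R x y} \<union> {y \<in> H. R x y}" for x using V(1) by auto
  have "(\<Sum>x\<in>L. card {y \<in> V. R x y}) = (\<Sum>x\<in>L. card {y \<in> L. R x y} + card {y \<in> H. R x y})"
    unfolding eq using V(2) fin by (intro sum.cong refl card_Un_disjoint) auto
  also have "\<dots> = card (SIGMA x:L. {y \<in> L. R x y}) + card (SIGMA x:L. {y \<in> H. R x y})"
    using fin by (simp add: sum.distrib)
  also have "(SIGMA x:L. {y \<in> H. R x y}) = {(x, y). x \<in> L \<and> y \<in> H \<and> R x y}" by auto
  finally show ?thesis using card_tournament_arcs[OF TL fin(1)] by simp
qed

lemma four_elements:
  assumes "card K = 4" "x \<in> K" "y \<in> K" "x \<noteq> y"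
  obtains s t where "K = {x, s, y, t}" "distinct [x, s, y, t]"
proof -
  have fin: "finite K" using assms(1) card.infinite by fastforce
  have "card (K - {x, y}) = 2" using assms fin by (simp add: card_Diff_subset)
  then obtain s t where st: "K - {x, y} = {s, t}" "s \<noteq> t" by (auto simp: card_2_iff)
  have "K = {x, s, y, t}" using st(1) assms(2,3) by blast
  moreover have "distinct [x, s, y, t]" using st assms(4) by auto
  ultimately show thesis by (rule that)
qed

text \<open>
  Used for the two tails and for the two heads of the arcs from \<open>L\<close> to \<open>H\<close>. These may coincide,
  and then an arbitrary second point is added.
\<close>
lemma two_points_containing:
  assumes "2 \<le> card K" "x \<in> K" "y \<in> K"
  obtains c d where "c \<in> K" "d \<in> K" "c \<noteq> d" "{x, y} \<subseteq> {c, d}" "x \<noteq> y \<Longrightarrow> c = x \<and> d = y"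
proof (cases "x = y")
  case True
  have "K \<noteq> {x}" using assms(1) by auto
  then obtain z where "z \<in> K" "z \<noteq> x" using assms(2) by blast
  then show thesis using that[of x z] True assms by auto
qed (use that[of x y] assms in auto)

text \<open>
  If the two arcs from \<open>L\<close> to \<open>H\<close> are disjoint, the order of the two remaining vertices \<open>s\<close>, \<open>t\<close> of \<open>H\<close> has to be chosen such that not both
  \<open>a'\<close> dominates the second and \<open>b'\<close> dominates the first. If both orders fail, then \<open>a'\<close> and \<open>b'\<close>
  dominate both \<open>s\<close> and \<open>t\<close>, and one of \<open>a'\<close>, \<open>b'\<close> dominates the other. That one dominates three vertices of \<open>H\<close>
  and, receiving only one arc from \<open>L\<close>, also three of \<open>L\<close>: its score is at least 6.
\<close>
lemma separable_positions_exist: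
  assumes T: "tournament_on V R" and V: "V = L \<union> H" "L \<inter> H = {}" "card L = 4" "card H = 4"
    and scoreL: "(\<Sum>x\<in>L. card {y \<in> V. R x y}) = 8"
    and scoreH: "\<And>x. x \<in> H \<Longrightarrow> card {y \<in> V. R x y} \<le> 5"
  obtains p where "cycle_separating V R p"
proof -
  have finL: "finite L" and finH: "finite H" using V card.infinite by fastforce+
  then have finV: "finite V" using V by simp
  define E where "E = {(x, y). x \<in> L \<and> y \<in> H \<and> R x y}"
  have "card E = 2"
    using card_arcs_out_of_set[OF T V(1,2) finV] scoreL V(3) unfolding E_def by simp
  then obtain x\<^sub>1 y\<^sub>1 x\<^sub>2 y\<^sub>2 where E: "E = {(x\<^sub>1, y\<^sub>1), (x\<^sub>2, y\<^sub>2)}" by (auto simp: card_2_iff)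
  then have inE: "x\<^sub>1 \<in> L" "y\<^sub>1 \<in> H" "x\<^sub>2 \<in> L" "y\<^sub>2 \<in> H" unfolding E_def by auto
  have up: "(x, y) \<in> {(x\<^sub>1, y\<^sub>1), (x\<^sub>2, y\<^sub>2)}" if "x \<in> L" "y \<in> H" "R x y" for x y
    using that E unfolding E_def by blast
  obtain a b where ab: "a \<in> L" "b \<in> L" "a \<noteq> b" "{x\<^sub>1, x\<^sub>2} \<subseteq> {a, b}" "x\<^sub>1 \<noteq> x\<^sub>2 \<Longrightarrow> a = x\<^sub>1 \<and> b = x\<^sub>2"
    by (rule two_points_containing[of L x\<^sub>1 x\<^sub>2]) (use inE V in auto)
  obtain a' b' where ab': "a' \<in> H" "b' \<in> H" "a' \<noteq> b'" "{y\<^sub>1, y\<^sub>2} \<subseteq> {a', b'}"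
      "y\<^sub>1 \<noteq> y\<^sub>2 \<Longrightarrow> a' = y\<^sub>1 \<and> b' = y\<^sub>2"
    by (rule two_points_containing[of H y\<^sub>1 y\<^sub>2]) (use inE V in auto)
  obtain m n where L: "L = {a, m, b, n}" "distinct [a, m, b, n]"
    using four_elements[OF V(3) ab(1-3)] .
  obtain s t where H: "H = {a', s, b', t}" "distinct [a', s, b', t]"
    using four_elements[OF V(4) ab'(1-3)] .
  (* The heads are distinct, so z receives only one of the two arcs from L. *)
  have score6: False if "z \<in> {a', b'}" "\<forall>w\<in>H - {z}. R z w" "x\<^sub>1 \<noteq> x\<^sub>2" "y\<^sub>1 \<noteq> y\<^sub>2" for z
  proof -
    (* The tail of the only arc from L to z. *)
    define x where "x = (if z = a' then a else b)"
    have "R z l" if "l \<in> L - {x}" for l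
    proof -
      have "\<not> R l z"
        using up[of l z] that \<open>z \<in> {a', b'}\<close> ab(5) ab'(1,2,3,5) \<open>x\<^sub>1 \<noteq> x\<^sub>2\<close> \<open>y\<^sub>1 \<noteq> y\<^sub>2\<close>
        by (auto simp: x_def)
      then show ?thesis using T that \<open>z \<in> {a', b'}\<close> ab'(1,2) V(1,2) unfolding tournament_on_def by blast
    qed
    then have "(L - {x}) \<union> (H - {z}) \<subseteq> {y \<in> V. R z y}" using that(2) V(1) by blast
    then have "card ((L - {x}) \<union> (H - {z})) \<le> card {y \<in> V. R z y}"
      using finV by (intro card_mono) auto
    moreover have "card ((L - {x}) \<union> (H - {z})) = card (L - {x}) + card (H - {z})"
      using finL finH V(2) by (intro card_Un_disjoint) auto
    moreover have "card (L - {x}) = 3" "card (H - {z}) = 3"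
      using ab ab' that(1) V(3,4) finL finH by (auto simp: x_def)
    ultimately show False using scoreH[of z] that(1) ab' by auto
  qed
  have "\<exists>u v. H = {a', u, v, b'} \<and> distinct [a', u, v, b'] \<and>
      (x\<^sub>1 \<noteq> x\<^sub>2 \<longrightarrow> y\<^sub>1 \<noteq> y\<^sub>2 \<longrightarrow> \<not> (R a' v \<and> R b' u))"
  proof (cases "x\<^sub>1 \<noteq> x\<^sub>2 \<and> y\<^sub>1 \<noteq> y\<^sub>2 \<and> R a' t \<and> R b' s")
    case True
    have "\<not> (R a' s \<and> R b' t)"
    proof
      assume st: "R a' s \<and> R b' t"
      have "R a' b' \<or> R b' a'" using T ab'(1-3) V(1) unfolding tournament_on_def by blast
      then show False using score6[of a'] score6[of b'] True st H(1) by auto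
    qed
    then show ?thesis using H by (intro exI[of _ t] exI[of _ s]) auto
  next
    case False
    then show ?thesis using H by (intro exI[of _ s] exI[of _ t]) auto
  qed
  then obtain u v where uv: "H = {a', u, v, b'}" "distinct [a', u, v, b']"
    "x\<^sub>1 \<noteq> x\<^sub>2 \<Longrightarrow> y\<^sub>1 \<noteq> y\<^sub>2 \<Longrightarrow> \<not> (R a' v \<and> R b' u)" by blast
  let ?vs = "[a, m, b, n, a', u, v, b']"
  have dist: "distinct ?vs" using L uv V(2) by auto
  have Vs: "V = {a, m, b, n, a', u, v, b'}" using L(1) uv(1) V(1) by auto
  define p :: "'a \<Rightarrow> real" where "p x = (if a = x then 0 else if m = x then 1 else if b = x then 2
    else if n = x then 3 else if a' = x then 4 else if u = x then 5 else if v = x then 6 else 7)" for x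
  have p: "map p ?vs = [0, 1, 2, 3, 4, 5, 6, 7]" using dist by (simp add: p_def)
  have "distinct (map p ?vs)" unfolding p by simp
  then have "inj_on p (set ?vs)" unfolding distinct_map by blast
  then have "inj_on p V" unfolding Vs list.set .
  moreover have "strictly_separable ((moment_curve \<circ> p) ` C) ((moment_curve \<circ> p) ` D)"
    if "C \<subseteq> V" "D \<subseteq> V" "C \<inter> D = {}" "nontrivially_strong R C" "nontrivially_strong R D" for C D
  proof (rule eight_points_separated[OF T Vs dist p])
    fix x y assume xy: "x \<in> {a, m, b, n}" "y \<in> {a', u, v, b'}" "R x y"
    then have 1: "(x, y) \<in> {(x\<^sub>1, y\<^sub>1), (x\<^sub>2, y\<^sub>2)}" by (intro up) (simp_all add: L(1) uv(1))
    then show "x \<in> {a, b} \<and> y \<in> {a', b'}" using ab(4) ab'(4) by blast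
    fix x' y' assume xy': "x' \<in> {a, m, b, n}" "y' \<in> {a', u, v, b'}" "R x' y'" "x \<noteq> x'" "y \<noteq> y'"
    have "(x', y') \<in> {(x\<^sub>1, y\<^sub>1), (x\<^sub>2, y\<^sub>2)}" using xy' by (intro up) (simp_all add: L(1) uv(1))
    then have "{(x, y), (x', y')} = {(x\<^sub>1, y\<^sub>1), (x\<^sub>2, y\<^sub>2)}" "x\<^sub>1 \<noteq> x\<^sub>2" "y\<^sub>1 \<noteq> y\<^sub>2" using 1 xy'(4,5) by auto
    then show "{(x, y), (x', y')} = {(a, a'), (b, b')} \<and> \<not> (R a' v \<and> R b' u)"
      using ab(5) ab'(5) uv(3) by auto
  qed (use that in blast)+
  ultimately have "cycle_separating V R p" unfolding cycle_separating_def by simp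
  then show thesis by (rule that)
qed

section \<open>Score sequences\<close>

lemma list_with_score_sequence:
  assumes "finite (verts G)"
  obtains vs where "distinct vs" "set vs = verts G" "map (out_degree G) vs = score_sequence G"
proof -
  obtain us where us: "mset us = mset_set (verts G)" using ex_mset by blast
  define vs where "vs = sort_key (out_degree G) us"
  have mset: "mset vs = mset_set (verts G)" by (simp add: vs_def us)
  have "map (out_degree G) vs = sort (map (out_degree G) us)"
    by (rule properties_for_sort[symmetric]) (simp_all add: vs_def)
  then have "map (out_degree G) vs = score_sequence G"
    unfolding score_sequence_def us[symmetric] by (simp flip: mset_map)
  moreover have "set vs = verts G" using mset assms by (metis finite_set_mset_mset_set set_mset_mset)
  moreover have "distinct vs"
    using mset assms \<open>set vs = verts G\<close> by (metis card_distinct size_mset size_mset_set)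
  ultimately show thesis using that by blast
qed

lemma (in digraph) out_degree_dominates:
  "out_degree G x = card {y \<in> verts G. x \<rightarrow>\<^bsub>G\<^esub> y}"
proof -
  have "{y \<in> verts G. x \<rightarrow>\<^bsub>G\<^esub> y} = head G ` out_arcs G x"
    by (auto simp: arcs_ends_conv out_arcs_def)
  moreover have "inj_on (head G) (out_arcs G x)"
    by (rule inj_onI) (auto simp: arc_to_ends_def intro: no_multi_arcs)
  ultimately show ?thesis by (simp add: out_degree_def card_image)
qed

lemma tournament_in_degree:
  assumes "tournament_on V R" "finite V" "x \<in> V"
  shows "card {y \<in> V. R\<inverse>\<inverse> x y} = card V - 1 - card {y \<in> V. R x y}"
proof -
  have "V - {x} = {y \<in> V. R\<inverse>\<inverse> x y} \<union> {y \<in> V. R x y}" "{y \<in> V. R\<inverse>\<inverse> x y} \<inter> {y \<in> V. R x y} = {}"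
    using assms(1,3) unfolding tournament_on_def conversep_iff by blast+
  then have "card (V - {x}) = card {y \<in> V. R\<inverse>\<inverse> x y} + card {y \<in> V. R x y}"
    using assms(2) by (simp add: card_Un_disjoint)
  then show ?thesis using assms by simp
qed

theorem corollary3p6:
  fixes T :: "('a, 'b) pre_digraph"
  assumes "tournament T"
    and "card (verts T) = 8"
    and "score_sequence T = [1,2,2,3,5,5,5,5] \<or>
         score_sequence T = [2,2,2,2,5,5,5,5] \<or>
         score_sequence T = [2,2,2,2,4,5,5,6]"
  shows "\<not> intrinsically_linked_digraph T"
proof -
  interpret digraph T using assms(1) by (simp add: tournament_def)
  let ?R = "dominates T" and ?V = "verts T"
  have T: "tournament_on ?V ?R" by (rule tournament_on_dominates[OF assms(1)])
  obtain vs where vs: "distinct vs" "set vs = ?V" "map (out_degree T) vs = score_sequence T"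
    using list_with_score_sequence[OF finite_verts] .
  define f where "f x = card {y \<in> ?V. ?R x y}" for x
  define g where "g x = card {y \<in> ?V. ?R\<inverse>\<inverse> x y}" for x
  have f: "map f vs = score_sequence T"
    unfolding vs(3)[symmetric] by (simp add: f_def out_degree_dominates)
  have gf: "g x = 7 - f x" if "x \<in> ?V" for x
    using tournament_in_degree[OF T finite_verts that] assms(2) by (simp add: f_def g_def)
  have g: "map g vs = map ((-) 7) (score_sequence T)"
    unfolding f[symmetric] using gf vs(2) by simp
  have len: "length vs = 8" using vs(1,2) assms(2) distinct_card by fastforce
  let ?A = "set (take 4 vs)" and ?B = "set (drop 4 vs)"
  have AB: "?V = ?A \<union> ?B" "?A \<inter> ?B = {}" "card ?A = 4" "card ?B = 4"
    using vs(1) len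
    by (simp_all flip: vs(2) set_append add: distinct_card set_take_disj_set_drop_if_distinct)
  have sumA: "sum h ?A = sum_list (take 4 (map h vs))" and sumB: "sum h ?B = sum_list (drop 4 (map h vs))"
    for h :: "'a \<Rightarrow> nat"
    using vs(1) by (simp_all add: sum.distinct_set_conv_list take_map drop_map)
  have inA: "h x \<in> set (take 4 (map h vs))" if "x \<in> ?A" for x and h :: "'a \<Rightarrow> nat"
    using that by (simp add: take_map)
  have inB: "h x \<in> set (drop 4 (map h vs))" if "x \<in> ?B" for x and h :: "'a \<Rightarrow> nat"
    using that by (simp add: drop_map)
  obtain p where "cycle_separating ?V ?R p"
  proof (cases "score_sequence T = [2,2,2,2,4,5,5,6]")
    case False
    then have seq: "map f vs = [1,2,2,3,5,5,5,5] \<or> map f vs = [2,2,2,2,5,5,5,5]" using f assms(3) by simp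
    have sum: "(\<Sum>x\<in>?A. card {y \<in> ?V. ?R x y}) = 8"
      unfolding f_def[symmetric] sumA using seq by auto
    have le: "card {y \<in> ?V. ?R x y} \<le> 5" if "x \<in> ?B" for x
      unfolding f_def[symmetric] using inB[OF that, of f] seq by auto
    show thesis using separable_positions_exist[OF T AB sum le] that by blast
  next
    case True
    (* With all arcs reversed, the four vertices of high score take the part of L. *)
    then have seq: "map g vs = [5,5,5,5,3,2,2,1]" using g by simp
    have T': "tournament_on ?V ?R\<inverse>\<inverse>" using T by (simp add: tournament_on_converse)
    have BA: "?V = ?B \<union> ?A" "?B \<inter> ?A = {}" using AB(1,2) by auto
    have sum: "(\<Sum>x\<in>?B. card {y \<in> ?V. ?R\<inverse>\<inverse> x y}) = 8"
      unfolding g_def[symmetric] sumB seq by simp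
    have le: "card {y \<in> ?V. ?R\<inverse>\<inverse> x y} \<le> 5" if "x \<in> ?A" for x
      unfolding g_def[symmetric] using inA[OF that, of g] seq by auto
    obtain p where "cycle_separating ?V ?R\<inverse>\<inverse> p"
      using separable_positions_exist[OF T' BA AB(4,3) sum le] by blast
    then show thesis using that[OF cycle_separating_converse] by blast
  qed
  then show ?thesis by (rule not_intrinsically_linked_if_separable[OF assms(1)])
qed

end
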